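(* There exist infinitely many $n$ and, for each of them, a threshold network $\mathcal{T}_n$ on a signed graph with $n$ vertices whose loopless part is the cycle $C_n$ (self-loops allowed), together with a periodic update mode $\mu_n$, such that the dynamics $x\mapsto F_{\mu_n}(x)$ of $\mathcal{T}_n$ has an attractor of period $p(n)$ that is super-polynomial in $n$ (i.e. for every polynomial $q$, $p(n)>q(n)$ for all sufficiently large $n$ in this family).
   Context: A signed graph has vertex set $V$, undirected edges between distinct vertices, self-loops, and a sign in $\{-1,+1\}$ on every edge and loop. Its interaction matrix $W=(w_{ij})$ is symmetric with $w_{ij}$ the sign of edge $\{i,j\}$ (or of the loop at $i$ when $i=j$) and $0$ if absent. A threshold network with thresholds $b\in\mathbb{Z}^V$ has local functions $f_i(x)=1$ if $\sum_{j}w_{ij}x_j-b_i>0$, $f_i(x)=x_i$ if it is $0$, $f_i(x)=-1$ otherwise, for $x\in\{-1,1\}^V$. For $I\subseteq V$, $f_I(x)_i=f_i(x)$ if $i\in I$, else $x_i$. A periodic update mode is a finite sequence $\mu=(I_1,\ldots,I_\ell)$ of subsets of $V$, with global map $F_\mu=f_{I_\ell}\circ\cdots\circ f_{I_1}$. An attractor of period $p$ is a configuration $x$ with $F_\mu^p(x)=x$ and $p\ge1$ minimal. *)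

theory Defs
  imports Complex_Main "HOL-Library.FuncSet" "HOL-Computational_Algebra.Polynomial"
begin

record 'v signed_graph =
  verts :: "'v set"
  edges :: "'v set set"
  loops :: "'v set"
  edge_sign :: "'v set \<Rightarrow> int"
  loop_sign :: "'v \<Rightarrow> int"

definition signed_graph :: "('v, 'm) signed_graph_scheme \<Rightarrow> bool" where
  "signed_graph G \<longleftrightarrow>
     finite (verts G) \<and>
     (\<forall>e\<in>edges G. e \<subseteq> verts G \<and> card e = 2) \<and>
     loops G \<subseteq> verts G \<and>
     (\<forall>e\<in>edges G. edge_sign G e \<in> {-1, 1}) \<and>
     (\<forall>v\<in>loops G. loop_sign G v \<in> {-1, 1})"

definition interaction :: "('v, 'm) signed_graph_scheme \<Rightarrow> 'v \<Rightarrow> 'v \<Rightarrow> int" where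
  "interaction G i j =
     (if i = j then (if i \<in> loops G then loop_sign G i else 0)
      else (if {i, j} \<in> edges G then edge_sign G {i, j} else 0))"

text \<open>The graph \<open>(verts G, edges G)\<close>, which ignores the loops and the signs,
  is isomorphic to the cycle \<open>C\<^sub>n\<close>.\<close>

definition loopless_part_is_cycle :: "('v, 'm) signed_graph_scheme \<Rightarrow> nat \<Rightarrow> bool" where
  "loopless_part_is_cycle G n \<longleftrightarrow>
     n \<ge> 3 \<and>
     (\<exists>h. bij_betw h {..<n} (verts G) \<and>
          edges G = (\<lambda>i. {h i, h (Suc i mod n)}) ` {..<n})"

record 'v threshold_network = "'v signed_graph" +
  threshold :: "'v \<Rightarrow> int"

text \<open>Configurations are extensional functions (\<open>undefined\<close> outside the vertex set), so that
  equality of configurations is agreement on all vertices.\<close>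

definition configurations :: "('v, 'm) signed_graph_scheme \<Rightarrow> ('v \<Rightarrow> int) set" where
  "configurations G = verts G \<rightarrow>\<^sub>E {-1, 1}"

definition local_fun ::
    "('v, 'm) threshold_network_scheme \<Rightarrow> 'v \<Rightarrow> ('v \<Rightarrow> int) \<Rightarrow> int" where
  "local_fun T i x =
     (let s = (\<Sum>j\<in>verts T. interaction T i j * x j) - threshold T i
      in if s > 0 then 1 else if s = 0 then x i else -1)"

definition block_update ::
    "('v, 'm) threshold_network_scheme \<Rightarrow> 'v set \<Rightarrow> ('v \<Rightarrow> int) \<Rightarrow> ('v \<Rightarrow> int)" where
  "block_update T I x = (\<lambda>i. if i \<in> I then local_fun T i x else x i)"

definition periodic_update_mode :: "('v, 'm) signed_graph_scheme \<Rightarrow> 'v set list \<Rightarrow> bool" where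
  "periodic_update_mode G \<mu> \<longleftrightarrow> (\<forall>I\<in>set \<mu>. I \<subseteq> verts G)"

text \<open>\<^const>\<open>fold\<close> applies the first block of \<open>\<mu>\<close> first.\<close>

definition global_map ::
    "('v, 'm) threshold_network_scheme \<Rightarrow> 'v set list \<Rightarrow> ('v \<Rightarrow> int) \<Rightarrow> ('v \<Rightarrow> int)" where
  "global_map T \<mu> = fold (block_update T) \<mu>"

definition attractor_of_period ::
    "('v, 'm) threshold_network_scheme \<Rightarrow> 'v set list \<Rightarrow> ('v \<Rightarrow> int) \<Rightarrow> nat \<Rightarrow> bool" where
  "attractor_of_period T \<mu> x p \<longleftrightarrow>
     x \<in> configurations T \<and>
     p \<ge> 1 \<and> (global_map T \<mu> ^^ p) x = x \<and>
     (\<forall>k. 1 \<le> k \<and> k < p \<longrightarrow> (global_map T \<mu> ^^ k) x \<noteq> x)"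

end

theory Submission imports Defs begin

text \<open>
  With positive edges, negative loops and zero thresholds, updating a vertex copies its two
  neighbours if they agree and flips the vertex if they disagree. Put a vertex frozen at \<open>1\<close> to the
  left and one frozen at \<open>-1\<close> to the right of a path of \<open>j - 1\<close> vertices. The configurations of the
  form \<open>1 \<dots> 1 -1 \<dots> -1\<close> on that path are determined by the number of ones, and one sweep from right
  to left increases this number by \<open>1\<close> modulo \<open>j\<close>. Placing such counters for \<open>j = 1, \<dots>, m\<close>, each
  in a window of width \<open>m + 1\<close>, on the cycle of length \<open>m (m + 1)\<close> gives an attractor of
  period \<open>lcm(1, \<dots>, m)\<close>. For any fixed finite set of primes, the largest power of each prime below
  \<open>m\<close> divides this number, so it eventually exceeds every fixed power of \<open>m\<close>.
\<close>

section \<open>The cycle network and its local rule\<close>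

definition cycle_edges :: "nat \<Rightarrow> nat set set" where
  "cycle_edges n = (\<lambda>i. {i, Suc i mod n}) ` {..<n}"

definition flip_cycle :: "nat \<Rightarrow> nat threshold_network" where
  "flip_cycle n = \<lparr>verts = {..<n}, edges = cycle_edges n, loops = {..<n},
     edge_sign = (\<lambda>_. 1), loop_sign = (\<lambda>_. -1), threshold = (\<lambda>_. 0)\<rparr>"

lemma flip_cycle_sel [simp]:
  "verts (flip_cycle n) = {..<n}" "edges (flip_cycle n) = cycle_edges n"
  "loops (flip_cycle n) = {..<n}" "edge_sign (flip_cycle n) e = 1"
  "loop_sign (flip_cycle n) v = -1" "threshold (flip_cycle n) v = 0"
  by (simp_all add: flip_cycle_def)

lemma signed_graph_flip_cycle:
  assumes "n \<ge> 3"
  shows "signed_graph (flip_cycle n)"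
proof -
  have "i \<noteq> Suc i mod n \<and> Suc i mod n < n" if "i < n" for i
    using that assms by (simp add: mod_Suc)
  then show ?thesis
    by (auto simp: signed_graph_def cycle_edges_def card_2_iff)
qed

lemma loopless_part_flip_cycle:
  assumes "n \<ge> 3"
  shows "loopless_part_is_cycle (flip_cycle n) n"
  using assms unfolding loopless_part_is_cycle_def
  by (auto simp: cycle_edges_def intro!: exI[of _ id])

lemma cycle_edges_iff:
  assumes "0 < v" "Suc v < n" "j < n"
  shows "{v, j} \<in> cycle_edges n \<longleftrightarrow> j = v - 1 \<or> j = Suc v"
proof
  assume "{v, j} \<in> cycle_edges n"
  then obtain i where "i < n" "{v, j} = {i, Suc i mod n}"
    by (auto simp: cycle_edges_def)
  then show "j = v - 1 \<or> j = Suc v"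
    using assms by (auto simp: doubleton_eq_iff mod_Suc split: if_splits)
next
  assume "j = v - 1 \<or> j = Suc v"
  then show "{v, j} \<in> cycle_edges n"
  proof
    assume "j = v - 1"
    then have "{v, j} = {v - 1, Suc (v - 1) mod n}" using assms by auto
    then show ?thesis using assms unfolding cycle_edges_def by (intro image_eqI[of _ _ "v - 1"]) auto
  next
    assume "j = Suc v"
    then show ?thesis using assms unfolding cycle_edges_def by (intro image_eqI[of _ _ v]) auto
  qed
qed

text \<open>The weighted sum is \<open>x (v - 1) + x (Suc v) - x v\<close>. Agreeing neighbours
  outweigh the negative loop; disagreeing ones cancel and leave \<open>- x v\<close>. The sum is
  odd, so the tie case never occurs. The bounds on \<open>v\<close> keep away from the edge joining
  \<open>n - 1\<close> and \<open>0\<close>.\<close>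

lemma local_fun_flip_cycle:
  assumes "0 < v" "Suc v < n" and x: "\<And>j. j < n \<Longrightarrow> x j \<in> {-1, 1}"
  shows "local_fun (flip_cycle n) v x = (if x (v - 1) = x (Suc v) then x (v - 1) else - x v)"
proof -
  have "(\<Sum>j\<in>{..<n}. interaction (flip_cycle n) v j * x j) =
        (\<Sum>j\<in>{v - 1, v, Suc v}. interaction (flip_cycle n) v j * x j)"
    using assms by (intro sum.mono_neutral_right) (auto simp: interaction_def cycle_edges_iff)
  also have "\<dots> = x (v - 1) + x (Suc v) - x v"
  proof -
    have "interaction (flip_cycle n) v (v - 1) = 1" "interaction (flip_cycle n) v (Suc v) = 1"
      "interaction (flip_cycle n) v v = -1"
      using assms by (auto simp: interaction_def cycle_edges_iff)
    moreover have "v - 1 \<noteq> v" "v - 1 \<noteq> Suc v" using assms by auto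
    ultimately show ?thesis by simp
  qed
  finally have "local_fun (flip_cycle n) v x =
      (let s = x (v - 1) + x (Suc v) - x v in if s > 0 then 1 else if s = 0 then x v else -1)"
    by (simp add: local_fun_def)
  then show ?thesis
    using x[of "v - 1"] x[of v] x[of "Suc v"] less_imp_diff_less[of v n 1] assms(1,2) by auto
qed

section \<open>Counters in disjoint windows and one sweep of them\<close>

lemma div_mod_window:
  fixes i b w :: nat
  assumes "i < w"
  shows "(i + b * w) div w = b" "(i + b * w) mod w = i"
  using assms by simp_all

text \<open>Vertex \<open>v\<close> is the cell at offset \<open>v mod Suc m\<close> of the window \<open>v div Suc m\<close>, whose counter runs
  modulo \<open>Suc (v div Suc m)\<close>.\<close>

definition counter_state :: "nat \<Rightarrow> nat \<Rightarrow> nat \<Rightarrow> int" where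
  "counter_state m k v =
     (if v < m * Suc m
      then (if v mod Suc m \<le> k mod Suc (v div Suc m) then 1 else -1)
      else undefined)"

text \<open>All windows are updated in parallel. The last condition keeps the cells to the right of
  each path frozen at \<open>-1\<close>.\<close>

definition offset_block :: "nat \<Rightarrow> nat \<Rightarrow> nat set" where
  "offset_block m i = {v. v < m * Suc m \<and> v mod Suc m = i \<and> i \<le> v div Suc m}"

text \<open>Offset \<open>0\<close> is left out, so the cells frozen at \<open>1\<close> are never
  updated.\<close>

definition sweep :: "nat \<Rightarrow> nat set list" where
  "sweep m = map (offset_block m) (rev [1..<Suc m])"

text \<open>The configuration in the middle of a sweep: offsets above \<open>i\<close> already show
  time \<open>Suc k\<close>.\<close>

definition partial_state :: "nat \<Rightarrow> nat \<Rightarrow> nat \<Rightarrow> nat \<Rightarrow> int" where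
  "partial_state m k i v = counter_state m (if v mod Suc m \<le> i then k else Suc k) v"

text \<open>At offset \<open>i\<close> the left neighbour shows time \<open>k\<close> and the right
  one time \<open>Suc k\<close>. With c the old number of ones, if the counter does not wrap, the
  neighbours disagree only at \<open>i\<close> = c + 1, where \<open>-1\<close> flips to
  \<open>1\<close>. If it wraps, they disagree along the whole path and every \<open>1\<close> flips
  to \<open>-1\<close>.\<close>

lemma block_update_partial_state:
  assumes "i \<le> m" "0 < i"
  shows "block_update (flip_cycle (m * Suc m)) (offset_block m i) (partial_state m k i) =
         partial_state m k (i - 1)"
proof
  fix v
  let ?T = "flip_cycle (m * Suc m)" and ?x = "partial_state m k i"
  let ?w = "Suc m" and ?j = "v div Suc m"
  show "block_update ?T (offset_block m i) ?x v = partial_state m k (i - 1) v"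
  proof (cases "v \<in> offset_block m i")
    case True
    then have v: "v < m * ?w" "v mod ?w = i" "i \<le> ?j" by (auto simp: offset_block_def)
    have j: "?j < m" using v(1) by (simp add: less_mult_imp_div_less)
    have v_eq: "v = ?j * ?w + i" using v(2) by (metis div_mult_mod_eq)
    have l: "(v - 1) div ?w = ?j" "(v - 1) mod ?w = i - 1"
    proof -
      have e: "v - 1 = (i - 1) + ?j * ?w" using v_eq assms by simp
      show "(v - 1) div ?w = ?j" "(v - 1) mod ?w = i - 1"
        unfolding e using assms by (intro div_mod_window; simp)+
    qed
    \<comment> \<open>Since \<open>i \<le> ?j < m\<close>, the right neighbour is still in the same
      window.\<close>
    have r: "Suc v div ?w = ?j" "Suc v mod ?w = Suc i"
    proof -
      have e: "Suc v = Suc i + ?j * ?w" using v_eq by simp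
      have "Suc i < ?w" using v(3) j by simp
      then show "Suc v div ?w = ?j" "Suc v mod ?w = Suc i"
        unfolding e by (intro div_mod_window; assumption)+
    qed
    have bound: "0 < v" "Suc v < m * ?w"
    proof -
      show "0 < v" using v(2) assms by (cases v) auto
      have "Suc v div ?w < m" using r j by simp
      then show "Suc v < m * ?w" by (simp add: div_less_iff_less_mult del: mult_Suc_right)
    qed
    have "local_fun ?T v ?x = (if ?x (v - 1) = ?x (Suc v) then ?x (v - 1) else - ?x v)"
      by (rule local_fun_flip_cycle[OF bound]) (simp add: partial_state_def counter_state_def)
    also have "\<dots> = counter_state m (Suc k) v"
    \<comment> \<open>\<open>mod_Suc\<close> separates the increment from the wrap to zero.\<close>
    proof -
      have "v - 1 < m * ?w" using bound by linarith
      moreover have "k mod Suc ?j < Suc ?j" by simp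
      ultimately show ?thesis
        using bound v l r assms
        by (auto simp: partial_state_def counter_state_def mod_Suc[of k] simp del: mult_Suc_right)
    qed
    finally show ?thesis
      using True assms v by (auto simp: block_update_def partial_state_def)
  next
    case False
    \<comment> \<open>A cell at offset \<open>i\<close> outside the block lies beyond its path,
      where the state is \<open>-1\<close> at all times.\<close>
    have "counter_state m (Suc k) v = counter_state m k v" if "v mod ?w = i"
    proof -
      have "v < m * ?w \<longrightarrow> Suc ?j \<le> i" using that False by (auto simp: offset_block_def)
      moreover have "l mod Suc ?j < Suc ?j" for l by simp
      ultimately have "v < m * ?w \<longrightarrow> l mod Suc ?j < i" for l by (meson order_less_le_trans)
      from this[of k] this[of "Suc k"] show ?thesis using that by (auto simp: counter_state_def simp del: mult_Suc_right)
    qed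
    then show ?thesis
      using False assms by (auto simp: block_update_def partial_state_def)
  qed
qed

lemma fold_block_update_partial_state:
  "i \<le> m \<Longrightarrow> fold (block_update (flip_cycle (m * Suc m))) (map (offset_block m) (rev [1..<Suc i]))
     (partial_state m k i) = partial_state m k 0"
proof (induction i)
  case (Suc i)
  have "rev [1..<Suc (Suc i)] = Suc i # rev [1..<Suc i]" by simp
  then show ?case
    using Suc block_update_partial_state[of "Suc i" m k]
    by (simp del: upt_Suc mult_Suc_right)
qed simp

lemma global_map_counter_state:
  "global_map (flip_cycle (m * Suc m)) (sweep m) (counter_state m k) = counter_state m (Suc k)"
proof -
  have "counter_state m k = partial_state m k m"
    by (simp add: partial_state_def fun_eq_iff)
  \<comment> \<open>Offset \<open>0\<close> carries \<open>1\<close> at all times, so the two sides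
    agree there too.\<close>
  moreover have "partial_state m k 0 = counter_state m (Suc k)"
    by (auto simp: partial_state_def fun_eq_iff counter_state_def)
  ultimately show ?thesis
    using fold_block_update_partial_state[of m m k] by (simp add: global_map_def sweep_def)
qed

section \<open>The period of the combined counters\<close>

lemma global_map_pow_counter_state:
  "(global_map (flip_cycle (m * Suc m)) (sweep m) ^^ k) (counter_state m 0) = counter_state m k"
  by (induction k) (simp_all add: global_map_counter_state del: mult_Suc_right)

lemma counter_state_eq_iff:
  "counter_state m k = counter_state m 0 \<longleftrightarrow> Lcm {1..m} dvd k"
proof
  assume eq: "counter_state m k = counter_state m 0"
  show "Lcm {1..m} dvd k"
  proof (rule Lcm_least)
    fix j assume j: "j \<in> {1..m}"
    \<comment> \<open>The cell at offset \<open>1\<close> of the window with modulus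
      \<open>j\<close> is \<open>1\<close> exactly when \<open>k mod j\<close> is nonzero.\<close>
    define v where "v = Suc ((j - 1) * Suc m)"
    have e: "v = 1 + (j - 1) * Suc m" by (simp add: v_def)
    have v: "v div Suc m = j - 1" "v mod Suc m = 1"
      unfolding e using j by (intro div_mod_window; simp)+
    have "v < m * Suc m"
      using v j by (auto simp: div_less_iff_less_mult[symmetric] simp del: mult_Suc_right)
    then show "j dvd k"
      using fun_cong[OF eq, of v] v j
      by (auto simp: counter_state_def dvd_eq_mod_eq_0 simp del: mult_Suc_right split: if_splits)
  qed
next
  assume *: "Lcm {1..m} dvd k"
  have "k mod Suc (v div Suc m) = 0" if "v < m * Suc m" for v
  proof -
    have "v div Suc m < m" using that by (simp add: less_mult_imp_div_less)
    then have "Suc (v div Suc m) dvd Lcm {1..m}" by (intro dvd_Lcm) auto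
    then show ?thesis using * by (meson dvd_trans dvd_imp_mod_0)
  qed
  then show "counter_state m k = counter_state m 0"
    by (auto simp: counter_state_def fun_eq_iff)
qed

lemma attractor_flip_cycle:
  "attractor_of_period (flip_cycle (m * Suc m)) (sweep m) (counter_state m 0) (Lcm {1..m})"
proof -
  have "1 \<le> Lcm {1..m}" by (simp add: Suc_le_eq Lcm_0_iff flip: neq0_conv)
  moreover have "counter_state m 0 \<in> configurations (flip_cycle (m * Suc m))"
    by (auto simp: configurations_def counter_state_def PiE_iff extensional_def)
  ultimately show ?thesis
    by (auto simp: attractor_of_period_def global_map_pow_counter_state counter_state_eq_iff
        simp del: mult_Suc_right dest: dvd_imp_le)
qed

section \<open>Superpolynomial growth of the least common multiple\<close>

lemma prod_dvd_if_pairwise_coprime: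
  fixes f :: "'a \<Rightarrow> 'b :: semiring_gcd"
  assumes "finite A" "\<And>a. a \<in> A \<Longrightarrow> f a dvd c"
    "\<And>a b. a \<in> A \<Longrightarrow> b \<in> A \<Longrightarrow> a \<noteq> b \<Longrightarrow> coprime (f a) (f b)"
  shows "prod f A dvd c"
  using assms
proof (induction A)
  case (insert a A)
  have "coprime (f a) (prod f A)"
    using insert by (intro prod_coprime_right) auto
  then show ?case using insert by (simp add: divides_mult)
qed simp

text \<open>For each \<open>p\<close> in \<open>P\<close>, the largest power of \<open>p\<close> not
  exceeding \<open>m\<close> divides the lcm and, times \<open>p\<close>, exceeds \<open>m\<close>.
  These powers are coprime, so their product divides the lcm as well.\<close>

lemma power_card_le_prod_primes_mult_Lcm:
  fixes m :: nat
  assumes "finite P" "\<And>p. p \<in> P \<Longrightarrow> prime p" "m \<ge> 1"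
  shows "m ^ card P \<le> \<Prod>P * Lcm {1..m}"
proof -
  have "\<exists>e. p ^ e \<le> m \<and> m < p ^ (e + 1)" if "p \<in> P" for p
    using ex_power_ivl1[of p m] assms(2)[OF that] assms(3) prime_ge_2_nat by blast
  then obtain e where e: "\<And>p. p \<in> P \<Longrightarrow> p ^ e p \<le> m \<and> m < p ^ (e p + 1)" by metis
  have "(\<Prod>p\<in>P. p ^ e p) dvd Lcm {1..m}"
  proof (rule prod_dvd_if_pairwise_coprime[OF assms(1)])
    show "p ^ e p dvd Lcm {1..m}" if "p \<in> P" for p
      using e[OF that] assms(2)[OF that] by (intro dvd_Lcm) (auto simp: prime_gt_0_nat Suc_le_eq)
    show "coprime (p ^ e p) (p' ^ e p')" if "p \<in> P" "p' \<in> P" "p \<noteq> p'" for p p'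
      using that assms(2) by (simp add: primes_coprime)
  qed
  then have le: "(\<Prod>p\<in>P. p ^ e p) \<le> Lcm {1..m}"
    by (intro dvd_imp_le) (auto simp: Lcm_0_iff intro!: Nat.gr0I)
  have "m ^ card P = (\<Prod>p\<in>P. m)" by simp
  also have "\<dots> \<le> (\<Prod>p\<in>P. p * p ^ e p)" using e by (intro prod_mono) (auto intro: less_imp_le)
  also have "\<dots> = \<Prod>P * (\<Prod>p\<in>P. p ^ e p)" by (simp add: prod.distrib)
  also have "\<dots> \<le> \<Prod>P * Lcm {1..m}" using le by simp
  finally show ?thesis .
qed

lemma poly_le_power:
  fixes q :: "real poly"
  obtains C where "C \<ge> 0" "\<And>x. x \<ge> 1 \<Longrightarrow> poly q x \<le> C * x ^ degree q"
proof
  show "0 \<le> (\<Sum>i\<le>degree q. \<bar>coeff q i\<bar>)" by (simp add: sum_nonneg)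
  fix x :: real assume x: "x \<ge> 1"
  have "poly q x = (\<Sum>i\<le>degree q. coeff q i * x ^ i)" by (rule poly_altdef)
  also have "\<dots> \<le> (\<Sum>i\<le>degree q. \<bar>coeff q i\<bar> * x ^ degree q)"
    using x by (intro sum_mono mult_mono power_increasing) auto
  finally show "poly q x \<le> (\<Sum>i\<le>degree q. \<bar>coeff q i\<bar>) * x ^ degree q"
    by (simp add: sum_distrib_right)
qed

lemma Lcm_superpolynomial:
  fixes q :: "real poly"
  shows "\<exists>m0. \<forall>m\<ge>m0. real (Lcm {1..m}) > poly q (real (m * Suc m))"
proof -
  define d where "d = degree q"
  obtain C where C: "C \<ge> 0" "\<And>x. x \<ge> 1 \<Longrightarrow> poly q x \<le> C * x ^ d"
    using poly_le_power[of q] unfolding d_def by blast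
  \<comment> \<open>As \<open>m * Suc m\<close> is at most \<open>2 * m ^ 2\<close>, the polynomial
    is bounded by a constant times \<open>m ^ (2 * d)\<close>. One prime more than
    \<open>2 * d\<close> leaves a spare factor \<open>m\<close> to absorb the constants.\<close>
  obtain P :: "nat set" where P: "finite P" "card P = 2 * d + 1" "P \<subseteq> {p. prime p}"
    using infinite_arbitrarily_large[OF primes_infinite] by blast
  define A where "A = \<Prod>P"
  have A: "A > 0" unfolding A_def using P by (auto intro!: prod_pos simp: prime_gt_0_nat)
  obtain M :: nat where M: "real M > real A * C * 2 ^ d" using reals_Archimedean2 by blast
  have "poly q (real (m * Suc m)) < real (Lcm {1..m})" if "m \<ge> M + 1" for m
  proof -
    have m: "m \<ge> 1" "real m > real A * C * 2 ^ d" using that M by auto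
    have "m ^ (2 * d + 1) \<le> A * Lcm {1..m}"
      using power_card_le_prod_primes_mult_Lcm[OF P(1), of m] P m by (auto simp: A_def)
    then have L: "real m ^ (2 * d + 1) \<le> real A * real (Lcm {1..m})"
      by (metis of_nat_le_iff of_nat_mult of_nat_power)
    have "m * Suc m \<le> 2 * m ^ 2" using m by (simp add: power2_eq_square)
    then have n: "real (m * Suc m) \<le> 2 * real m ^ 2"
      by (metis of_nat_le_iff of_nat_mult of_nat_numeral of_nat_power)
    have "poly q (real (m * Suc m)) \<le> C * real (m * Suc m) ^ d"
      using m by (intro C) (simp del: of_nat_mult of_nat_Suc)
    also have "\<dots> \<le> C * (2 * real m ^ 2) ^ d"
      using n C by (intro mult_left_mono power_mono) auto
    finally have "real A * poly q (real (m * Suc m)) \<le> real A * (C * (2 * real m ^ 2) ^ d)"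
      by (intro mult_left_mono) auto
    also have "\<dots> = (real A * C * 2 ^ d) * real m ^ (2 * d)"
      by (simp add: power_mult_distrib power_mult)
    also have "\<dots> < real m * real m ^ (2 * d)"
      using m by (intro mult_strict_right_mono) auto
    also have "\<dots> \<le> real A * real (Lcm {1..m})" using L by simp
    finally show ?thesis using A by simp
  qed
  then show ?thesis by blast
qed

theorem theorem6:
  "\<exists>(N :: nat set) (T :: nat \<Rightarrow> nat threshold_network) (\<mu> :: nat \<Rightarrow> nat set list) (p :: nat \<Rightarrow> nat).
     infinite N \<and>
     (\<forall>n\<in>N.
        signed_graph (T n) \<and>
        card (verts (T n)) = n \<and>
        loopless_part_is_cycle (T n) n \<and>
        periodic_update_mode (T n) (\<mu> n) \<and>
        (\<exists>x. attractor_of_period (T n) (\<mu> n) x (p n))) \<and>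
     (\<forall>q :: real poly. \<exists>n0. \<forall>n\<in>N. n \<ge> n0 \<longrightarrow> real (p n) > poly q (real n))"
proof -
  define f :: "nat \<Rightarrow> nat" where "f m = m * Suc m" for m
  have mono: "strict_mono f"
    by (simp add: strict_mono_Suc_iff f_def)
  then have inj: "inj f" by (rule strict_mono_imp_inj_on)
  then have inv: "inv f (f m) = m" for m by simp
  \<comment> \<open>Starting at \<open>2\<close> makes the cycle length at least
    \<open>3\<close>.\<close>
  have "infinite (f ` {2..})"
    using inj infinite_Ici finite_imageD inj_on_subset by blast
  moreover have "signed_graph (flip_cycle n) \<and> card (verts (flip_cycle n)) = n \<and>
      loopless_part_is_cycle (flip_cycle n) n \<and>
      periodic_update_mode (flip_cycle n) (sweep (inv f n)) \<and>
      (\<exists>x. attractor_of_period (flip_cycle n) (sweep (inv f n)) x (Lcm {1..inv f n}))"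
    if "n \<in> f ` {2..}" for n
  proof -
    obtain m where m: "m \<ge> 2" "n = f m" using \<open>n \<in> f ` {2..}\<close> by auto
    have "f 2 \<le> n" using mono m by (simp add: strict_mono_less_eq)
    then have "n \<ge> 3" by (simp add: f_def)
    moreover have "periodic_update_mode (flip_cycle n) (sweep m)"
      unfolding m f_def by (auto simp: periodic_update_mode_def sweep_def offset_block_def)
    ultimately show ?thesis
      using signed_graph_flip_cycle loopless_part_flip_cycle attractor_flip_cycle[of m] m inv
      by (auto simp: f_def)
  qed
  moreover have "\<exists>n0. \<forall>n\<in>f ` {2..}. n \<ge> n0 \<longrightarrow> real (Lcm {1..inv f n}) > poly q (real n)"
    for q :: "real poly"
  proof -
    obtain m0 where m0: "\<And>m. m \<ge> m0 \<Longrightarrow> real (Lcm {1..m}) > poly q (real (f m))"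
      using Lcm_superpolynomial[of q] unfolding f_def by blast
    have "real (Lcm {1..inv f n}) > poly q (real n)" if "n \<in> f ` {2..}" "n \<ge> f m0" for n
      using that m0 mono by (auto simp: inv strict_mono_less_eq)
    then show ?thesis by blast
  qed
  ultimately show ?thesis
    by (intro exI[of _ "f ` {2..}"] exI[of _ flip_cycle] exI[of _ "\<lambda>n. sweep (inv f n)"]
        exI[of _ "\<lambda>n. Lcm {1..inv f n}"]) blast
qed

end
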